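(* Let $S$ be a boolean representable simplicial complex and let $1\leq k\leq 3$. Then $\mathrm{pure}(T_k(S))$ is a TBRSC.
   Context: A (finite) simplicial complex is a pair $S=(V,\mathcal{H})$ where $V$ is a finite nonempty set and $\mathcal{H}\subseteq 2^V$ contains all singletons and is closed under taking subsets. Its dimension $d$ is $\max\{|I|:I\in\mathcal{H}\}-1$. $P_n(V)$ (resp. $P_{\leq n}(V)$) is the set of subsets of $V$ of size exactly (resp. at most) $n$. $S$ is boolean representable (BRSC) if there is a boolean matrix $M$ with columns indexed by $V$ such that $\mathcal{H}$ is exactly the set of $X\subseteq V$ for which some square submatrix with column set $X$ is congruent (by permuting rows and columns) to a lower unitriangular boolean matrix. For $k\geq 1$, $T_k(S)=(V,\mathcal{H}\cap P_{\leq k}(V))$; $S$ is a TBRSC if $S=T_k(S')$ for some BRSC $S'$ and $k\geq1$. The pure core of $S$ is $\mathrm{pure}(S)=(V',\mathcal{H}')$ where $V'=\bigcup(\mathcal{H}\cap P_{d+1}(V))$ and $\mathcal{H}'=\bigcup\{2^X : X\in\mathcal{H}\cap P_{d+1}(V)\}$. *)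

theory Defs
  imports Main
begin

type_synonym 'a scomplex = "'a set \<times> 'a set set"

definition simplicial_complex :: "'a scomplex \<Rightarrow> bool" where
  "simplicial_complex S \<longleftrightarrow>
     (case S of (V, H) \<Rightarrow>
        finite V \<and> V \<noteq> {} \<and> H \<subseteq> Pow V \<and> (\<forall>v\<in>V. {v} \<in> H) \<and>
        (\<forall>X\<in>H. \<forall>Y. Y \<subseteq> X \<longrightarrow> Y \<in> H))"

text \<open>Singletons are faces and the vertex set is nonempty, so the truncated
  subtraction is harmless: the maximum is at least 1.\<close>

definition scomplex_dim :: "'a scomplex \<Rightarrow> nat" where
  "scomplex_dim S = Max (card ` snd S) - 1"

definition P_eq :: "nat \<Rightarrow> 'a set \<Rightarrow> 'a set set" where
  "P_eq n V = {X. X \<subseteq> V \<and> card X = n}"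

definition P_le :: "nat \<Rightarrow> 'a set \<Rightarrow> 'a set set" where
  "P_le n V = {X. X \<subseteq> V \<and> card X \<le> n}"

definition lower_unitriangular :: "nat \<Rightarrow> (nat \<Rightarrow> nat \<Rightarrow> bool) \<Rightarrow> bool" where
  "lower_unitriangular n A \<longleftrightarrow>
     (\<forall>i<n. A i i) \<and> (\<forall>i<n. \<forall>j<n. i < j \<longrightarrow> \<not> A i j)"

text \<open>A boolean matrix with \<open>m\<close> rows and columns indexed by a set of vertices is
  a function \<open>M :: nat \<Rightarrow> 'a \<Rightarrow> bool\<close>, of which only the rows \<open>{..<m}\<close> matter.
  The square submatrix with row set \<open>R\<close> and column set \<open>X\<close> is put into
  triangular form by enumerating its rows by \<open>r\<close> and its columns by \<open>c\<close>, i.e. by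
  independent row and column permutations. The empty set is always independent,
  through the \<open>0 \<times> 0\<close> submatrix.\<close>

definition independent_columns :: "nat \<Rightarrow> (nat \<Rightarrow> 'a \<Rightarrow> bool) \<Rightarrow> 'a set \<Rightarrow> bool" where
  "independent_columns m M X \<longleftrightarrow>
     (\<exists>R n r c. R \<subseteq> {..<m} \<and>
        bij_betw r {..<n} R \<and> bij_betw c {..<n} X \<and>
        lower_unitriangular n (\<lambda>i j. M (r i) (c j)))"

definition BRSC :: "'a scomplex \<Rightarrow> bool" where
  "BRSC S \<longleftrightarrow> simplicial_complex S \<and>
     (\<exists>m (M :: nat \<Rightarrow> 'a \<Rightarrow> bool).
        snd S = {X. X \<subseteq> fst S \<and> independent_columns m M X})"

definition truncation :: "nat \<Rightarrow> 'a scomplex \<Rightarrow> 'a scomplex" where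
  "truncation k S = (fst S, snd S \<inter> P_le k (fst S))"

definition TBRSC :: "'a scomplex \<Rightarrow> bool" where
  "TBRSC S \<longleftrightarrow> (\<exists>S' k. BRSC S' \<and> k \<ge> 1 \<and> S = truncation k S')"

definition pure_core :: "'a scomplex \<Rightarrow> 'a scomplex" where
  "pure_core S =
     (let F = snd S \<inter> P_eq (scomplex_dim S + 1) (fst S) in (\<Union>F, \<Union>X\<in>F. Pow X))"

end

theory Submission
  imports Defs
begin

text \<open>
  A boolean matrix enters only through the family of zero sets of its rows, and in terms of this
  family a set is independent iff its elements can be added one at a time, each new one being
  separated from the previous ones by a member of the family. Let \<open>n\<close> be the largest size of a face
  of the truncation. For \<open>n \<le> 2\<close> every face with at most \<open>n\<close> elements lies in one with \<open>n\<close> elements: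
  for \<open>n = 2\<close> this is because the complement of the edge graph is an equivalence relation, so that
  no vertex is isolated as soon as there is an edge.

  For \<open>n = 3\<close> an edge may fail to lie in a triangle. This happens exactly when both of its ends are
  \<^emph>\<open>degenerate\<close>, that is, when no proper flat contains such a vertex together with a vertex
  inequivalent to it. Replacing the members of the family which meet the set \<open>B\<close> of degenerate
  vertices by the single set \<open>B\<close> makes all of these vertices equivalent. This removes exactly the
  unwanted edges and does not change the triangles.
\<close>

section \<open>Independence through zero sets, and its agreement with boolean matrices\<close>

inductive indep :: "'a set set \<Rightarrow> 'a set \<Rightarrow> bool" for F where
  empty: "indep F {}"
| insert: "indep F Y \<Longrightarrow> Z \<in> F \<Longrightarrow> Y \<subseteq> Z \<Longrightarrow> x \<notin> Z \<Longrightarrow> indep F (insert x Y)"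

lemma indep_finite: "indep F X \<Longrightarrow> finite X"
  by (induction rule: indep.induct) auto

lemma indep_singleton: "Z \<in> F \<Longrightarrow> v \<notin> Z \<Longrightarrow> indep F {v}"
  using indep.insert[OF indep.empty] by simp

lemma indep_subset: "indep F X \<Longrightarrow> Y \<subseteq> X \<Longrightarrow> indep F Y"
proof (induction arbitrary: Y rule: indep.induct)
  case empty
  then show ?case by (simp add: indep.empty)
next
  case (insert X Z x)
  show ?case
  proof (cases "x \<in> Y")
    case True
    have "indep F (Y - {x})" using insert.IH insert.prems by blast
    then have "indep F (insert x (Y - {x}))"
      by (rule indep.insert[OF _ insert.hyps(2)]) (use insert in auto)
    with True show ?thesis by (simp add: insert_absorb)
  next
    case False
    then show ?thesis using insert.IH insert.prems by blast
  qed
qed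

text \<open>With \<open>Z i\<close> the zero set of row \<open>i\<close>, the hypothesis is lower
  unitriangularity. Column 0 lies outside \<open>Z 0\<close> and all later columns lie inside, so it
  is the element inserted last; the induction therefore peels off index 0.\<close>

lemma indep_sequence:
  fixes n :: nat
  assumes "\<forall>i<n. Z i \<in> F \<and> c i \<notin> Z i \<and> (\<forall>j<n. i < j \<longrightarrow> c j \<in> Z i)"
  shows "indep F (c ` {..<n})"
  using assms
proof (induction n arbitrary: c Z)
  case 0
  then show ?case by (simp add: indep.empty)
next
  case (Suc n)
  have "indep F ((\<lambda>i. c (Suc i)) ` {..<n})"
    by (rule Suc.IH[of "\<lambda>i. Z (Suc i)"]) (use Suc.prems in auto)
  then have "indep F (insert (c 0) ((\<lambda>i. c (Suc i)) ` {..<n}))"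
    by (rule indep.insert[of _ _ "Z 0"]) (use Suc.prems in auto)
  then show ?case by (simp add: lessThan_Suc_eq_insert_0 image_image)
qed

lemma indep_obtain_sequence:
  assumes "indep F X"
  obtains n :: nat and Z c where "X = c ` {..<n}"
    and "\<forall>i<n. Z i \<in> F \<and> c i \<notin> Z i \<and> (\<forall>j<n. i < j \<longrightarrow> c j \<in> Z i)"
proof -
  have "\<exists>(n::nat) Z c. X = c ` {..<n} \<and>
      (\<forall>i<n. Z i \<in> F \<and> c i \<notin> Z i \<and> (\<forall>j<n. i < j \<longrightarrow> c j \<in> Z i))"
    using assms
  proof (induction rule: indep.induct)
    case empty
    show ?case by (rule exI[of _ 0]) simp
  next
    case (insert Y W x)
    then obtain n :: nat and Z c where Y: "Y = c ` {..<n}"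
      and Z: "\<forall>i<n. Z i \<in> F \<and> c i \<notin> Z i \<and> (\<forall>j<n. i < j \<longrightarrow> c j \<in> Z i)" by blast
    have "insert x Y = case_nat x c ` {..<Suc n}"
      by (simp add: Y lessThan_Suc_eq_insert_0 image_image)
    moreover have "\<forall>i<Suc n. case_nat W Z i \<in> F \<and> case_nat x c i \<notin> case_nat W Z i \<and>
        (\<forall>j<Suc n. i < j \<longrightarrow> case_nat x c j \<in> case_nat W Z i)"
      using Z insert.hyps Y by (auto split: nat.split)
    ultimately show ?case by blast
  qed
  with that show thesis by blast
qed

lemma independent_columns_iff_indep:
  "independent_columns m M X \<longleftrightarrow> indep ((\<lambda>i. {v. \<not> M i v}) ` {..<m}) X"
proof
  assume "independent_columns m M X"
  then obtain R n r c where R: "R \<subseteq> {..<m}" and r: "bij_betw r {..<n} R"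
    and c: "bij_betw c {..<n} X" and tri: "lower_unitriangular n (\<lambda>i j. M (r i) (c j))"
    unfolding independent_columns_def by blast
  have "indep ((\<lambda>i. {v. \<not> M i v}) ` {..<m}) (c ` {..<n})"
    by (rule indep_sequence[of _ "\<lambda>i. {v. \<not> M (r i) v}"])
      (use tri R bij_betw_imp_surj_on[OF r] in \<open>auto simp: lower_unitriangular_def\<close>)
  then show "indep ((\<lambda>i. {v. \<not> M i v}) ` {..<m}) X"
    using bij_betw_imp_surj_on[OF c] by simp
next
  assume "indep ((\<lambda>i. {v. \<not> M i v}) ` {..<m}) X"
  then obtain n :: nat and Z c where X: "X = c ` {..<n}"
    and Z: "\<forall>i<n. Z i \<in> (\<lambda>i. {v. \<not> M i v}) ` {..<m} \<and> c i \<notin> Z i \<and> (\<forall>j<n. i < j \<longrightarrow> c j \<in> Z i)"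
    by (rule indep_obtain_sequence)
  then have "\<forall>i. \<exists>k. i < n \<longrightarrow> k < m \<and> Z i = {v. \<not> M k v}" by blast
  then obtain r where r: "\<forall>i<n. r i < m \<and> Z i = {v. \<not> M (r i) v}" by metis
  have diag: "M (r i) (c i)" if "i < n" for i using Z r that by fastforce
  have upper: "\<not> M (r i) (c j)" if "i < j" "j < n" for i j
  proof -
    have "i < n" using that by simp
    then show ?thesis using Z r that by blast
  qed
  \<comment> \<open>The triangular shape forces distinctness. For \<open>i < j\<close>, the entry
    \<open>M (r j) (c j)\<close> is true and \<open>M (r i) (c j)\<close> false, so the rows differ;
    \<open>M (r i) (c i)\<close> is true and \<open>M (r i) (c j)\<close> false, so the columns
    differ.\<close>
  have "inj_on r {..<n}"
    by (rule linorder_inj_onI) (metis diag upper lessThan_iff, auto)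
  moreover have "inj_on c {..<n}"
    by (rule linorder_inj_onI) (metis diag upper lessThan_iff, auto)
  ultimately show "independent_columns m M X"
    unfolding independent_columns_def lower_unitriangular_def bij_betw_def
    using X r diag upper
    by (intro exI[of _ "r ` {..<n}"] exI[of _ n] exI[of _ r] exI[of _ c]) auto
qed

text \<open>Every finite family consists of the zero sets of the rows of some matrix. That each
  vertex is missed by a member says that singletons are faces; closure under subsets comes from
  \<open>indep_subset\<close>.\<close>

lemma BRSC_iff_indep:
  "BRSC (V, H) \<longleftrightarrow> finite V \<and> V \<noteq> {} \<and>
     (\<exists>F. finite F \<and> (\<forall>v\<in>V. \<exists>Z\<in>F. v \<notin> Z) \<and> H = {X. X \<subseteq> V \<and> indep F X})"
    (is "_ \<longleftrightarrow> ?R")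
proof
  assume B: "BRSC (V, H)"
  then have "simplicial_complex (V, H)" by (simp add: BRSC_def)
  then have S: "finite V" "V \<noteq> {}" "\<forall>v\<in>V. {v} \<in> H" by (simp_all add: simplicial_complex_def)
  from B have "\<exists>m (M :: nat \<Rightarrow> 'a \<Rightarrow> bool). H = {X. X \<subseteq> V \<and> independent_columns m M X}"
    by (simp add: BRSC_def)
  then obtain m and M :: "nat \<Rightarrow> 'a \<Rightarrow> bool"
    where "H = {X. X \<subseteq> V \<and> independent_columns m M X}" by (elim exE)
  then have H: "H = {X. X \<subseteq> V \<and> indep ((\<lambda>i. {v. \<not> M i v}) ` {..<m}) X}"
    unfolding independent_columns_iff_indep .
  let ?F = "(\<lambda>i. {v. \<not> M i v}) ` {..<m}"
  have "\<exists>Z\<in>?F. v \<notin> Z" if "v \<in> V" for v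
  proof -
    have "indep ?F {v}" using H S(3) that by blast
    then show ?thesis by cases auto
  qed
  moreover have "finite ?F" by simp
  ultimately show ?R using S(1,2) H by blast
next
  assume ?R
  then obtain F where V: "finite V" "V \<noteq> {}" and "finite F" and F: "\<forall>v\<in>V. \<exists>Z\<in>F. v \<notin> Z"
    and H: "H = {X. X \<subseteq> V \<and> indep F X}" by blast
  from \<open>finite F\<close> obtain m :: nat and f where f: "F = f ` {..<m}"
    using finite_imp_nat_seg_image_inj_on[of F] by (auto simp: lessThan_def)
  have "indep F {v}" if "v \<in> V" for v
    using F that indep_singleton by metis
  then have "simplicial_complex (V, H)"
    using V H indep_subset by (fastforce simp: simplicial_complex_def)
  moreover have "H = {X. X \<subseteq> V \<and> independent_columns m (\<lambda>i v. v \<notin> f i) X}"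
    unfolding independent_columns_iff_indep H f by simp
  ultimately show "BRSC (V, H)" unfolding BRSC_def by auto
qed

section \<open>Edges and triangles of a family\<close>

definition separates :: "'a set set \<Rightarrow> 'a \<Rightarrow> 'a \<Rightarrow> bool" where
  "separates F x y \<longleftrightarrow> (\<exists>Z\<in>F. (x \<in> Z) \<noteq> (y \<in> Z))"

text \<open>Ordered form of a 3-element face: \<open>z\<close> is the vertex inserted last, after
  the edge on \<open>x\<close> and \<open>y\<close>.\<close>

definition triangle :: "'a set set \<Rightarrow> 'a \<Rightarrow> 'a \<Rightarrow> 'a \<Rightarrow> bool" where
  "triangle F x y z \<longleftrightarrow> separates F x y \<and> (\<exists>Z\<in>F. x \<in> Z \<and> y \<in> Z \<and> z \<notin> Z)"

text \<open>Contrapositive form of transitivity for the relation of lying in the same members of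
  \<open>F\<close>.\<close>

lemma separates_cases: "separates F x y \<Longrightarrow> separates F v x \<or> separates F v y"
  by (auto simp: separates_def)

text \<open>Looks at the last insertion: \<open>x\<close> is new because \<open>Z\<close> contains
  \<open>Y\<close> but not \<open>x\<close>. Iterating this describes the faces of sizes 1, 2 and
  3.\<close>

lemma indep_card_Suc_iff:
  "indep F X \<and> card X = Suc n \<longleftrightarrow>
     (\<exists>x Y Z. X = insert x Y \<and> indep F Y \<and> card Y = n \<and> Z \<in> F \<and> Y \<subseteq> Z \<and> x \<notin> Z)"
proof
  assume X: "indep F X \<and> card X = Suc n"
  then have "indep F X" ..
  then show "\<exists>x Y Z. X = insert x Y \<and> indep F Y \<and> card Y = n \<and> Z \<in> F \<and> Y \<subseteq> Z \<and> x \<notin> Z"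
  proof cases
    case empty
    with X show ?thesis by simp
  next
    case (insert Y Z x)
    moreover have "card X = Suc (card Y)"
      using insert indep_finite[of F Y] by (subst insert(1), subst card_insert_disjoint) auto
    ultimately show ?thesis using X by auto
  qed
next
  assume "\<exists>x Y Z. X = insert x Y \<and> indep F Y \<and> card Y = n \<and> Z \<in> F \<and> Y \<subseteq> Z \<and> x \<notin> Z"
  then obtain x Y Z where *: "X = insert x Y" "indep F Y" "card Y = n" "Z \<in> F" "Y \<subseteq> Z" "x \<notin> Z"
    by blast
  moreover have "x \<notin> Y" using * by blast
  ultimately show "indep F X \<and> card X = Suc n"
    using indep_finite[of F Y] indep.insert[of F Y Z x] by auto
qed

lemma indep_card_1_iff: "indep F X \<and> card X = 1 \<longleftrightarrow> (\<exists>x. X = {x} \<and> (\<exists>Z\<in>F. x \<notin> Z))"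
proof -
  have "indep F Y \<and> card Y = 0 \<longleftrightarrow> Y = {}" for Y
    using indep_finite[of F Y] indep.empty by auto
  then show ?thesis unfolding One_nat_def indep_card_Suc_iff by blast
qed

lemma indep_card_2_iff:
  assumes "\<forall>v\<in>X. \<exists>Z\<in>F. v \<notin> Z"
  shows "indep F X \<and> card X = 2 \<longleftrightarrow> (\<exists>x y. X = {x, y} \<and> separates F x y)"
proof
  assume "indep F X \<and> card X = 2"
  then obtain x Y Z where "X = insert x Y" "indep F Y \<and> card Y = 1" "Z \<in> F" "Y \<subseteq> Z" "x \<notin> Z"
    unfolding Suc_1[symmetric] indep_card_Suc_iff by auto
  then show "\<exists>x y. X = {x, y} \<and> separates F x y"
    unfolding indep_card_1_iff separates_def by blast
next
  assume "\<exists>x y. X = {x, y} \<and> separates F x y"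
  \<comment> \<open>The separating set may contain either end, so the ends are named such that
    \<open>x\<close>, the one outside, is inserted last.\<close>
  then obtain x y Z where "X = {x, y}" "Z \<in> F" "x \<notin> Z" "y \<in> Z"
    unfolding separates_def by (metis insert_commute)
  moreover from this have "indep F {y} \<and> card {y} = 1"
    using assms unfolding indep_card_1_iff by blast
  ultimately show "indep F X \<and> card X = 2"
    unfolding Suc_1[symmetric] indep_card_Suc_iff
    by (intro exI[of _ x] exI[of _ "{y}"] exI[of _ Z]) simp
qed

lemma indep_card_3_iff:
  assumes "\<forall>v\<in>X. \<exists>Z\<in>F. v \<notin> Z"
  shows "indep F X \<and> card X = 3 \<longleftrightarrow> (\<exists>x y z. X = {x, y, z} \<and> triangle F x y z)"
proof
  assume "indep F X \<and> card X = 3"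
  then obtain z Y Z where X: "X = insert z Y" and Y: "indep F Y \<and> card Y = 2"
    and Z: "Z \<in> F" "Y \<subseteq> Z" "z \<notin> Z"
    unfolding numeral_3_eq_3 numeral_2_eq_2 indep_card_Suc_iff[of _ X] by blast
  from Y obtain x y where "Y = {x, y}" "separates F x y"
    using indep_card_2_iff[of Y F] assms X by blast
  with X Z have "X = {x, y, z}" "triangle F x y z" unfolding triangle_def by auto
  then show "\<exists>x y z. X = {x, y, z} \<and> triangle F x y z" by blast
next
  assume "\<exists>x y z. X = {x, y, z} \<and> triangle F x y z"
  then obtain x y z Z where X: "X = {x, y, z}" and s: "separates F x y"
    and Z: "Z \<in> F" "x \<in> Z" "y \<in> Z" "z \<notin> Z"
    unfolding triangle_def by blast
  have "indep F {x, y} \<and> card {x, y} = 2"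
    using indep_card_2_iff[of "{x, y}" F] assms X s by blast
  with X Z show "indep F X \<and> card X = 3"
    unfolding numeral_3_eq_3 numeral_2_eq_2 indep_card_Suc_iff[of _ X]
    by (intro exI[of _ z] exI[of _ "{x, y}"] exI[of _ Z]) auto
qed

text \<open>The ends of \<open>e\<close> are separated, so any vertex is separated from one of them.
  This settles size 2 for the original family and is reused for the collapsed family in size
  3.\<close>

lemma indep_extend_2:
  assumes F: "\<forall>v\<in>V. \<exists>Z\<in>F. v \<notin> Z" and e: "e \<subseteq> V" "indep F e" "card e = 2"
    and X: "X \<subseteq> V" "indep F X" "card X \<le> 2"
  shows "\<exists>Y. Y \<subseteq> V \<and> X \<subseteq> Y \<and> indep F Y \<and> card Y = 2"
proof -
  consider "card X = 0" | "card X = 1" | "card X = 2" using X(3) by linarith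
  then show ?thesis
  proof cases
    case 1
    then have "X = {}" using indep_finite[OF X(2)] by simp
    then show ?thesis using e by blast
  next
    case 2
    then obtain v where v: "X = {v}" by (auto simp: card_1_singleton_iff)
    obtain x y where e': "e = {x, y}" "separates F x y"
      using indep_card_2_iff[of e F] e F by blast
    then obtain w where w: "w \<in> e" "separates F v w" using separates_cases[of F x y v] by blast
    then have "indep F {v, w} \<and> card {v, w} = 2"
      using indep_card_2_iff[of "{v, w}" F] F X v e(1) by blast
    with v w X e show ?thesis by (intro exI[of _ "{v, w}"]) auto
  next
    case 3
    with X show ?thesis by blast
  qed
qed

section \<open>Collapsing the degenerate vertices\<close>

text \<open>Members of \<open>F\<close> may contain elements outside \<open>V\<close>, so
  \<open>Z\<close> counts as improper when \<open>V \<subseteq> Z\<close>.\<close>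

definition degenerate :: "'a set \<Rightarrow> 'a set set \<Rightarrow> 'a set" where
  "degenerate V F =
     {a \<in> V. \<forall>c\<in>V. \<forall>Z\<in>F. separates F a c \<longrightarrow> a \<in> Z \<longrightarrow> c \<in> Z \<longrightarrow> V \<subseteq> Z}"

text \<open>The empty set keeps all singletons independent when every vertex is degenerate.\<close>

definition collapse :: "'a set \<Rightarrow> 'a set set \<Rightarrow> 'a set set" where
  "collapse V F = {{}, degenerate V F} \<union> {Z \<in> F. Z \<inter> degenerate V F = {}}"

lemma degenerate_line:
  assumes "a \<in> degenerate V F" "c \<in> V" "separates F a c" "Z \<in> F" "a \<in> Z" "c \<in> Z"
  shows "V \<subseteq> Z"
  using assms unfolding degenerate_def by blast

text \<open>Vertices in the same members of \<open>F\<close> are separated from the same vertices.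
  Hence the degenerate set is a union of classes, and adding it to the family separates no
  equivalent vertices.\<close>

lemma degenerate_equivalent:
  assumes "a \<in> degenerate V F" "c \<in> V" "\<not> separates F a c"
  shows "c \<in> degenerate V F"
proof -
  have eq: "\<And>Z. Z \<in> F \<Longrightarrow> a \<in> Z \<longleftrightarrow> c \<in> Z" using assms(3) by (auto simp: separates_def)
  then have "\<And>d. separates F c d \<longleftrightarrow> separates F a d" by (auto simp: separates_def)
  with assms eq show ?thesis unfolding degenerate_def by auto
qed

text \<open>A degenerate vertex in \<open>Z\<close> would either be separated from \<open>x\<close>,
  making \<open>Z\<close> improper, or be equivalent to \<open>x\<close>, making \<open>x\<close>
  degenerate.\<close>

lemma mem_collapse_if_not_degenerate:
  assumes "Z \<in> F" "x \<in> Z" "x \<in> V" "x \<notin> degenerate V F" "\<not> V \<subseteq> Z"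
  shows "Z \<in> collapse V F"
proof -
  have "a \<notin> Z" if "a \<in> degenerate V F" for a
    using degenerate_line[OF that] degenerate_equivalent[OF that] assms by blast
  then show ?thesis using assms(1) by (auto simp: collapse_def)
qed

lemma separates_collapse_iff:
  assumes V: "x \<in> V" "y \<in> V"
  shows "separates (collapse V F) x y \<longleftrightarrow>
    separates F x y \<and> (x \<notin> degenerate V F \<or> y \<notin> degenerate V F)" (is "?L \<longleftrightarrow> ?R")
proof
  assume ?L
  then obtain Z where Z: "Z \<in> collapse V F" "(x \<in> Z) \<noteq> (y \<in> Z)" by (auto simp: separates_def)
  show ?R
  proof (cases "Z = degenerate V F")
    case True
    moreover have "separates F y x \<longleftrightarrow> separates F x y" by (auto simp: separates_def)
    ultimately show ?thesis
      using Z V degenerate_equivalent[of x V F y] degenerate_equivalent[of y V F x] by blast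
  next
    case False
    \<comment> \<open>A separating set is nonempty, so \<open>Z\<close> is an old member disjoint
      from the degenerate set, and whichever of \<open>x\<close>, \<open>y\<close> it contains is
      nondegenerate.\<close>
    with Z have "Z \<in> F" "Z \<inter> degenerate V F = {}" by (auto simp: collapse_def)
    then show ?thesis using Z unfolding separates_def by blast
  qed
next
  assume R: ?R
  show ?L
  \<comment> \<open>If exactly one end is degenerate, the degenerate set itself separates. Otherwise
    neither is, and the old separating set survives.\<close>
  proof (cases "x \<in> degenerate V F \<longleftrightarrow> y \<in> degenerate V F")
    case True
    from R obtain Z where Z: "Z \<in> F" "(x \<in> Z) \<noteq> (y \<in> Z)" by (auto simp: separates_def)
    then have "Z \<in> collapse V F"
      using mem_collapse_if_not_degenerate[of Z F x V] mem_collapse_if_not_degenerate[of Z F y V]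
        True R V by blast
    then show ?thesis using Z unfolding separates_def by blast
  next
    case False
    then show ?thesis unfolding separates_def collapse_def by blast
  qed
qed

text \<open>The set witnessing a triangle is proper and contains a separated pair, so it survives
  the collapse. Conversely, the degenerate set cannot be a witness, since the collapse separates no
  two of its vertices.\<close>

lemma triangle_collapse_iff:
  assumes V: "x \<in> V" "y \<in> V" "z \<in> V"
  shows "triangle (collapse V F) x y z \<longleftrightarrow> triangle F x y z"
proof
  assume "triangle (collapse V F) x y z"
  then obtain Z where s: "separates (collapse V F) x y"
    and Z: "Z \<in> collapse V F" "x \<in> Z" "y \<in> Z" "z \<notin> Z"
    unfolding triangle_def by blast
  then have "separates F x y" "Z \<noteq> degenerate V F"
    using separates_collapse_iff[OF V(1,2), of F] by auto
  moreover from this have "Z \<in> F" using Z by (auto simp: collapse_def)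
  ultimately show "triangle F x y z" using Z unfolding triangle_def by blast
next
  assume "triangle F x y z"
  then obtain Z where s: "separates F x y"
    and Z: "Z \<in> F" "x \<in> Z" "y \<in> Z" "z \<notin> Z"
    unfolding triangle_def by blast
  have nd: "x \<notin> degenerate V F \<or> y \<notin> degenerate V F"
    using degenerate_line[OF _ V(2) s Z(1-3)] V Z by blast
  then have "Z \<in> collapse V F"
    using mem_collapse_if_not_degenerate[OF Z(1,2) V(1)]
      mem_collapse_if_not_degenerate[OF Z(1,3) V(2)] V Z by blast
  moreover have "separates (collapse V F) x y"
    using separates_collapse_iff[OF V(1,2), of F] s nd by blast
  ultimately show "triangle (collapse V F) x y z" using Z unfolding triangle_def by blast
qed

lemma indep_collapse_card_3_iff:
  assumes "\<forall>v\<in>V. \<exists>Z\<in>F. v \<notin> Z" "X \<subseteq> V"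
  shows "indep (collapse V F) X \<and> card X = 3 \<longleftrightarrow> indep F X \<and> card X = 3"
proof -
  have "\<forall>v\<in>X. \<exists>Z\<in>F. v \<notin> Z" "\<forall>v\<in>X. \<exists>Z\<in>collapse V F. v \<notin> Z"
    using assms by (auto simp: collapse_def)
  note iff = this[THEN indep_card_3_iff]
  have "X = {x, y, z} \<and> triangle (collapse V F) x y z \<longleftrightarrow> X = {x, y, z} \<and> triangle F x y z" for x y z
    using assms(2) triangle_collapse_iff[of x V y z F] by auto
  then show ?thesis unfolding iff by simp
qed

text \<open>Nondegeneracy of \<open>x\<close> gives a proper \<open>Z\<close> containing
  \<open>x\<close> and a separated \<open>c\<close>. If \<open>y\<close> is in \<open>Z\<close>, a
  vertex outside \<open>Z\<close> completes the edge; if not, \<open>y\<close> completes the edge on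
  \<open>x\<close> and \<open>c\<close>.\<close>

lemma triangle_extends_edge:
  assumes "x \<in> V" "x \<notin> degenerate V F" "y \<in> V" "separates F x y"
  shows "\<exists>u v. u \<in> V \<and> v \<in> V \<and> y \<in> {u, v} \<and> triangle F x u v"
proof -
  from assms obtain c Z where c: "c \<in> V" "separates F x c" and Z: "Z \<in> F" "x \<in> Z" "c \<in> Z" "\<not> V \<subseteq> Z"
    unfolding degenerate_def by blast
  show ?thesis
  proof (cases "y \<in> Z")
    case True
    then show ?thesis using assms Z unfolding triangle_def by blast
  next
    case False
    then show ?thesis using assms c Z unfolding triangle_def by blast
  qed
qed

text \<open>Edges that survive the collapse have a nondegenerate end, hence lie in a triangle of
  \<open>F\<close>, which is also one of the collapse. Smaller faces are first enlarged to an
  edge.\<close>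

lemma indep_collapse_extend_3:
  assumes F: "\<forall>v\<in>V. \<exists>Z\<in>F. v \<notin> Z" and t: "t \<subseteq> V" "indep (collapse V F) t" "card t = 3"
    and X: "X \<subseteq> V" "indep (collapse V F) X" "card X \<le> 3"
  shows "\<exists>Y. Y \<subseteq> V \<and> X \<subseteq> Y \<and> indep (collapse V F) Y \<and> card Y = 3"
proof -
  let ?C = "collapse V F"
  have C: "\<forall>v\<in>V. \<exists>Z\<in>?C. v \<notin> Z" by (auto simp: collapse_def)
  have edge: "\<exists>Y. Y \<subseteq> V \<and> e \<subseteq> Y \<and> indep ?C Y \<and> card Y = 3"
    if e: "e \<subseteq> V" "indep ?C e" "card e = 2" for e
  proof -
    obtain x y where xy: "e = {x, y}" "separates ?C x y"
      using indep_card_2_iff[of e ?C] e C by blast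
    then have s: "separates F x y" "separates F y x"
      and nd: "x \<notin> degenerate V F \<or> y \<notin> degenerate V F"
      using separates_collapse_iff[of x V y F] e by (auto simp: separates_def)
    obtain p q r where pqr: "p \<in> V" "q \<in> V" "r \<in> V" "e \<subseteq> {p, q, r}" "triangle F p q r"
      using nd triangle_extends_edge[of x V F y] triangle_extends_edge[of y V F x] s xy e by blast
    then have "indep ?C {p, q, r} \<and> card {p, q, r} = 3"
      using indep_card_3_iff[of "{p, q, r}" ?C] C triangle_collapse_iff[of p V q r F] by blast
    with pqr show ?thesis by (intro exI[of _ "{p, q, r}"]) auto
  qed
  show ?thesis
  proof (cases "card X = 3")
    case True
    with X show ?thesis by blast
  next
    case False
    then have X2: "card X \<le> 2" using X by simp
    \<comment> \<open>An edge inside \<open>t\<close> supplies the edge that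
      \<open>indep_extend_2\<close> requires.\<close>
    have "2 \<le> card t" using t(3) by simp
    then obtain e0 where e0: "e0 \<subseteq> t" "card e0 = 2"
      by (rule obtain_subset_with_card_n)
    have "e0 \<subseteq> V" "indep ?C e0" using e0 t indep_subset[OF t(2)] by auto
    from indep_extend_2[OF C this e0(2) X(1,2) X2]
    obtain e where "e \<subseteq> V" "X \<subseteq> e" "indep ?C e" "card e = 2" by blast
    with edge[of e] show ?thesis by blast
  qed
qed

section \<open>Pure families and the pure core of a truncation\<close>

text \<open>Provides a family with the same faces of size \<open>n\<close> in which all smaller
  faces extend to size \<open>n\<close>: \<open>F\<close> itself for \<open>n \<le> 2\<close>, its
  collapse for \<open>n = 3\<close>.\<close>

lemma exists_pure_family:
  assumes F: "finite F" "\<forall>v\<in>V. \<exists>Z\<in>F. v \<notin> Z" and n: "1 \<le> n" "n \<le> 3"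
    and W: "W \<subseteq> V" "indep F W" "card W = n"
  shows "\<exists>G. finite G \<and> (\<forall>v\<in>V. \<exists>Z\<in>G. v \<notin> Z) \<and>
    (\<forall>X. X \<subseteq> V \<and> card X = n \<longrightarrow> (indep G X \<longleftrightarrow> indep F X)) \<and>
    (\<forall>X. X \<subseteq> V \<and> indep G X \<and> card X \<le> n \<longrightarrow>
      (\<exists>Y. Y \<subseteq> V \<and> X \<subseteq> Y \<and> indep G Y \<and> card Y = n))"
proof -
  consider "n = 1" | "n = 2" | "n = 3" using n by linarith
  then show ?thesis
  proof cases
    case 1
    have "\<exists>Y. Y \<subseteq> V \<and> X \<subseteq> Y \<and> indep F Y \<and> card Y = n"
      if X: "X \<subseteq> V" "indep F X" "card X \<le> n" for X
    proof (cases "card X = n")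
      case False
      then have "card X = 0" using X 1 by linarith
      then have "X = {}" using indep_finite[OF X(2)] by simp
      with W show ?thesis by blast
    qed (use X in blast)
    with F show ?thesis by (intro exI[of _ F]) simp
  next
    case 2
    have "\<exists>Y. Y \<subseteq> V \<and> X \<subseteq> Y \<and> indep F Y \<and> card Y = n"
      if "X \<subseteq> V" "indep F X" "card X \<le> n" for X
      using indep_extend_2[OF F(2) W(1,2) _ that(1,2)] that(3) W(3) unfolding 2 by blast
    with F show ?thesis by (intro exI[of _ F]) simp
  next
    case 3
    have C: "finite (collapse V F)" "\<forall>v\<in>V. \<exists>Z\<in>collapse V F. v \<notin> Z"
      using F(1) by (auto simp: collapse_def)
    have eq: "indep (collapse V F) X \<longleftrightarrow> indep F X" if "X \<subseteq> V" "card X = n" for X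
      using indep_collapse_card_3_iff[OF F(2) that(1)] that(2) 3 by blast
    have "indep (collapse V F) W" using eq W by blast
    then have "\<exists>Y. Y \<subseteq> V \<and> X \<subseteq> Y \<and> indep (collapse V F) Y \<and> card Y = n"
      if "X \<subseteq> V" "indep (collapse V F) X" "card X \<le> n" for X
      using indep_collapse_extend_3[OF F(2) W(1) _ _ that(1,2)] that(3) W(3) unfolding 3 by blast
    with C eq show ?thesis by (intro exI[of _ "collapse V F"]) simp
  qed
qed

lemma pure_core_truncation:
  assumes S: "simplicial_complex S" and k: "1 \<le> k"
  obtains n W where "1 \<le> n" "n \<le> k" "W \<in> snd S" "card W = n"
    and "pure_core (truncation k S) =
      (\<Union>(snd S \<inter> P_eq n (fst S)), \<Union>X\<in>snd S \<inter> P_eq n (fst S). Pow X)"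
proof -
  obtain V H where VH: "S = (V, H)" by fastforce
  let ?T = "H \<inter> P_le k V"
  \<comment> \<open>The largest face size, possibly below \<open>k\<close>. Singletons make it at
    least 1, so subtracting 1 for the dimension and adding it back is exact.\<close>
  let ?n = "Max (card ` ?T)"
  have V: "finite V" "V \<noteq> {}" "H \<subseteq> Pow V" "\<forall>v\<in>V. {v} \<in> H"
    using S by (auto simp: VH simplicial_complex_def)
  then obtain v where v: "v \<in> V" by blast
  have fin: "finite (card ` ?T)" using V finite_subset[of H "Pow V"] by auto
  have v1: "1 \<in> card ` ?T"
    by (rule rev_image_eqI[of "{v}"]) (use V v k in \<open>auto simp: P_le_def\<close>)
  then have "?n \<in> card ` ?T" using fin Max_in by blast
  then obtain W where W: "W \<in> H" "card W = ?n" "card W \<le> k" by (auto simp: P_le_def)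
  have n1: "1 \<le> ?n" using fin v1 by simp
  have "H \<inter> P_le k V \<inter> P_eq ?n V = H \<inter> P_eq ?n V"
    using W by (auto simp: P_le_def P_eq_def)
  moreover have "scomplex_dim (truncation k S) + 1 = ?n"
    using n1 by (simp add: VH scomplex_dim_def truncation_def)
  ultimately have "pure_core (truncation k S) = (\<Union>(H \<inter> P_eq ?n V), \<Union>X\<in>H \<inter> P_eq ?n V. Pow X)"
    unfolding pure_core_def Let_def by (simp add: VH truncation_def)
  with that[of ?n W] W n1 show thesis by (simp add: VH)
qed

theorem theorem7p13:
  fixes S :: "'a scomplex" and k :: nat
  assumes "BRSC S" and "1 \<le> k" and "k \<le> 3"
  shows "TBRSC (pure_core (truncation k S))"
proof -
  obtain V H where S: "S = (V, H)" by fastforce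
  then obtain F where V: "finite V" "V \<noteq> {}" and F: "finite F" "\<forall>v\<in>V. \<exists>Z\<in>F. v \<notin> Z"
    and H: "H = {X. X \<subseteq> V \<and> indep F X}"
    using assms(1) BRSC_iff_indep[of V H] by blast
  have "simplicial_complex S" using assms(1) by (simp add: BRSC_def)
  from pure_core_truncation[OF this assms(2)]
  obtain n W where n: "1 \<le> n" "n \<le> k" and W: "W \<in> H" "card W = n"
    and pure: "pure_core (truncation k S) = (\<Union>(H \<inter> P_eq n V), \<Union>X\<in>H \<inter> P_eq n V. Pow X)"
    unfolding S fst_conv snd_conv by metis
  have W': "W \<subseteq> V" "indep F W" "n \<le> 3" using W H n assms(3) by auto
  obtain G where G: "finite G" "\<forall>v\<in>V. \<exists>Z\<in>G. v \<notin> Z"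
    and eq: "\<forall>X. X \<subseteq> V \<and> card X = n \<longrightarrow> (indep G X \<longleftrightarrow> indep F X)"
    and ext: "\<forall>X. X \<subseteq> V \<and> indep G X \<and> card X \<le> n \<longrightarrow>
      (\<exists>Y. Y \<subseteq> V \<and> X \<subseteq> Y \<and> indep G Y \<and> card Y = n)"
    using exists_pure_family[OF F n(1) W'(3) W'(1,2) W(2)] by (elim exE conjE)
  have top: "H \<inter> P_eq n V = {X. X \<subseteq> V \<and> indep G X \<and> card X = n}"
    using eq unfolding H P_eq_def by blast
  \<comment> \<open>Each singleton is a face of size at most \<open>n\<close>, so it extends to a
    face of size \<open>n\<close> and no vertex is lost.\<close>
  have verts: "\<Union>(H \<inter> P_eq n V) = V"
  proof
    show "V \<subseteq> \<Union>(H \<inter> P_eq n V)"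
    proof
      fix v assume v: "v \<in> V"
      then have "indep G {v}" using G(2) indep_singleton by metis
      then show "v \<in> \<Union>(H \<inter> P_eq n V)" using ext[rule_format, of "{v}"] v n(1) unfolding top by auto
    qed
  qed (auto simp: P_eq_def)
  have faces: "(\<Union>X\<in>H \<inter> P_eq n V. Pow X) = {X. X \<subseteq> V \<and> indep G X} \<inter> P_le n V"
  proof
    show "(\<Union>X\<in>H \<inter> P_eq n V. Pow X) \<subseteq> {X. X \<subseteq> V \<and> indep G X} \<inter> P_le n V"
    proof
      fix X assume "X \<in> (\<Union>X\<in>H \<inter> P_eq n V. Pow X)"
      then obtain Y where "Y \<subseteq> V" "indep G Y" "card Y = n" "X \<subseteq> Y" unfolding top by blast
      then show "X \<in> {X. X \<subseteq> V \<and> indep G X} \<inter> P_le n V"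
        using indep_subset[of G Y X] indep_finite[of G Y] card_mono[of Y X]
        by (auto simp: P_le_def)
    qed
    show "{X. X \<subseteq> V \<and> indep G X} \<inter> P_le n V \<subseteq> (\<Union>X\<in>H \<inter> P_eq n V. Pow X)"
      unfolding top P_le_def using ext by blast
  qed
  \<comment> \<open>\<open>G\<close> may have independent sets larger than \<open>n\<close>;
    truncating at \<open>n\<close>, rather than at \<open>k\<close>, removes them.\<close>
  let ?S' = "(V, {X. X \<subseteq> V \<and> indep G X})"
  have "BRSC ?S'" unfolding BRSC_iff_indep using V G by blast
  moreover have "pure_core (truncation k S) = truncation n ?S'"
    unfolding pure verts faces by (simp add: truncation_def)
  ultimately show ?thesis using n(1) unfolding TBRSC_def by blast
qed

end
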